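(* Let $n\ge 0$. On triangulations of the convex $(n+2)$-gon with vertices labeled $1,\dots,n+2$, the map $h$ acts by relabeling each vertex $i$ as $n+3-i$. Equivalently, $h(T)$ is the triangulation whose edges are $(n+3-i,\,n+3-j)$ for $(i,j)$ an edge of $T$.
   Context: A Catalan structure is a quadruple $(C,e,\lambda,\oplus)$ where $C=\bigsqcup_{n\ge 0}C_n$ with $C_0=\{e\}$ ($|t|=n$ for $t\in C_n$), $\lambda\colon C_n\to C_{n+1}$, $\oplus\colon C_m\times C_n\to C_{m+n}$, $\oplus$ is associative with two-sided identity $e$, and every $t\in C$ can be written uniquely in exactly one of three forms: $t=e$; $t=\lambda(s)$ (indecomposable); $t=u\oplus v$ with $u$ indecomposable and $v\neq e$ (decomposable). Every nonempty $t$ is then uniquely $\lambda(u)\oplus v$ ($v=e$ allowed). Put $\gamma(t)=t\oplus\lambda(e)$ and define $\ominus$ by $e\ominus v=v$, $\lambda(u)\ominus v=\lambda(u\ominus v)$, $(t\oplus u)\ominus v=t\oplus(u\ominus v)$ for $t,u\ne e$. The map $h$ is defined by $h(e)=e$, $h(\lambda(u)\oplus v)=h(v)\ominus\gamma(h(u))$. Triangulations form a Catalan structure as follows. A triangulation of size $n$ is a maximal set of non-crossing diagonals of the convex $(n+2)$-gon with vertices labeled $1,\dots,n+2$ clockwise (its edges are these diagonals together with the boundary edges); for $n=0$ it is the single edge $(1,2)$, which is $e$. $\lambda(T)$ for $T$ of size $n$: relabel each vertex $i\mapsto i+1$ and add a new vertex $1$ adjacent to $2$ and to $n+3$. $T_1\oplus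 T_2$ with $|T_1|=n_1$: identify the edge $(1,n_1+2)$ of $T_1$ with the edge $(1,2)$ of $T_2$, keeping the labels of $T_1$, with vertex $1$ of $T_2$ becoming $1$ and vertex $j\ge 2$ of $T_2$ becoming $n_1+j$. *)

theory Defs
  imports Main
begin

section \<open>Catalan structures\<close>

locale catalan_signature =
  fixes C :: "nat \<Rightarrow> 'a set"
    and e :: 'a
    and lam :: "'a \<Rightarrow> 'a"
    and oplus :: "'a \<Rightarrow> 'a \<Rightarrow> 'a"  (infixr "\<oplus>" 65)
begin

definition carrier :: "'a set" where
  "carrier = (\<Union>n. C n)"

definition indecomposable :: "'a \<Rightarrow> bool" where
  "indecomposable t \<longleftrightarrow> (\<exists>s\<in>carrier. t = lam s)"

definition decomposable :: "'a \<Rightarrow> bool" where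
  "decomposable t \<longleftrightarrow> (\<exists>u v. indecomposable u \<and> v \<in> carrier \<and> v \<noteq> e \<and> t = u \<oplus> v)"

definition gamma :: "'a \<Rightarrow> 'a" where
  "gamma t = t \<oplus> lam e"

text \<open>
  The recursive clauses for \<open>ominus\<close> and \<open>h\<close> do not match on constructors, so each operation is
  given by the graph generated by its clauses. In a Catalan structure both graphs are
  single-valued and total on the carrier, and the operations satisfy the clauses; this is proved
  in the locale \<open>catalan_structure\<close> below.
\<close>

inductive ominus_graph :: "'a \<Rightarrow> 'a \<Rightarrow> 'a \<Rightarrow> bool" where
  og_e: "v \<in> carrier \<Longrightarrow> ominus_graph e v v"
| og_lam: "\<lbrakk>u \<in> carrier; v \<in> carrier; ominus_graph u v w\<rbrakk> \<Longrightarrow> ominus_graph (lam u) v (lam w)"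
| og_oplus: "\<lbrakk>t \<in> carrier; t \<noteq> e; u \<in> carrier; u \<noteq> e; v \<in> carrier; ominus_graph u v w\<rbrakk>
    \<Longrightarrow> ominus_graph (t \<oplus> u) v (t \<oplus> w)"

definition ominus :: "'a \<Rightarrow> 'a \<Rightarrow> 'a"  (infixr "\<ominus>" 65) where
  "t \<ominus> v = (THE w. ominus_graph t v w)"

inductive h_graph :: "'a \<Rightarrow> 'a \<Rightarrow> bool" where
  hg_e: "h_graph e e"
| hg_lam: "\<lbrakk>u \<in> carrier; v \<in> carrier; h_graph u u'; h_graph v v'\<rbrakk>
    \<Longrightarrow> h_graph (lam u \<oplus> v) (v' \<ominus> gamma u')"

definition h :: "'a \<Rightarrow> 'a" where
  "h t = (THE t'. h_graph t t')"

end

locale catalan_structure = catalan_signature C e lam oplus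
  for C :: "nat \<Rightarrow> 'a set" and e :: 'a and lam :: "'a \<Rightarrow> 'a"
    and oplus :: "'a \<Rightarrow> 'a \<Rightarrow> 'a"  (infixr "\<oplus>" 65) +
  assumes C_disjoint: "m \<noteq> n \<Longrightarrow> C m \<inter> C n = {}"
    and C_0: "C 0 = {e}"
    and lam_closed: "t \<in> C n \<Longrightarrow> lam t \<in> C (Suc n)"
    and oplus_closed: "\<lbrakk>s \<in> C m; t \<in> C n\<rbrakk> \<Longrightarrow> s \<oplus> t \<in> C (m + n)"
    and oplus_assoc:
      "\<lbrakk>r \<in> carrier; s \<in> carrier; t \<in> carrier\<rbrakk> \<Longrightarrow> (r \<oplus> s) \<oplus> t = r \<oplus> (s \<oplus> t)"
    and oplus_e_left: "t \<in> carrier \<Longrightarrow> e \<oplus> t = t"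
    and oplus_e_right: "t \<in> carrier \<Longrightarrow> t \<oplus> e = t"
    and forms_exhaustive: "t \<in> carrier \<Longrightarrow> t = e \<or> indecomposable t \<or> decomposable t"
    and e_not_indecomposable: "\<not> indecomposable e"
    and e_not_decomposable: "\<not> decomposable e"
    and indecomposable_not_decomposable: "indecomposable t \<Longrightarrow> \<not> decomposable t"
    and indecomposable_unique: "\<lbrakk>s \<in> carrier; s' \<in> carrier; lam s = lam s'\<rbrakk> \<Longrightarrow> s = s'"
    and decomposable_unique:
      "\<lbrakk>indecomposable u; v \<in> carrier; v \<noteq> e; indecomposable u'; v' \<in> carrier; v' \<noteq> e;
        u \<oplus> v = u' \<oplus> v'\<rbrakk> \<Longrightarrow> u = u' \<and> v = v'"
begin

lemma carrierI: "t \<in> C n \<Longrightarrow> t \<in> carrier"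
  by (auto simp: carrier_def)

lemma carrierE: assumes "t \<in> carrier" obtains n where "t \<in> C n"
  using assms by (auto simp: carrier_def)

lemma e_carrier: "e \<in> carrier"
  using C_0 carrierI by blast

lemma lam_carrier: "t \<in> carrier \<Longrightarrow> lam t \<in> carrier"
  using lam_closed by (auto simp: carrier_def)

lemma oplus_carrier: "s \<in> carrier \<Longrightarrow> t \<in> carrier \<Longrightarrow> s \<oplus> t \<in> carrier"
  using oplus_closed unfolding carrier_def by blast

lemma size_unique: "t \<in> C m \<Longrightarrow> t \<in> C n \<Longrightarrow> m = n"
  using C_disjoint by blast

lemma size_pos: "t \<in> C n \<Longrightarrow> t \<noteq> e \<Longrightarrow> 0 < n"
  using C_0 by (cases n) auto

lemma oplus_eq_e: 
  assumes "s \<in> carrier" "t \<in> carrier" "t \<noteq> e"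
  shows "s \<oplus> t \<noteq> e"
proof -
  obtain m n where mn: "s \<in> C m" "t \<in> C n"
    using assms carrierE by metis
  have "e \<in> C 0"
    using C_0 by blast
  then show ?thesis
    using oplus_closed[OF mn] size_unique size_pos[OF mn(2) assms(3)] by fastforce
qed

lemma lam_neq_e: "s \<in> carrier \<Longrightarrow> lam s \<noteq> e"
  using e_not_indecomposable by (auto simp: indecomposable_def)

lemma nonempty_form:
  assumes "t \<in> carrier" "t \<noteq> e"
  obtains u v where "u \<in> carrier" "v \<in> carrier" "t = lam u \<oplus> v"
  using forms_exhaustive[OF assms(1)] assms(2)
  unfolding indecomposable_def decomposable_def
  by (metis e_carrier lam_carrier oplus_e_right)

lemma nonempty_form_unique:
  assumes "u \<in> carrier" "v \<in> carrier" "u' \<in> carrier" "v' \<in> carrier" "lam u \<oplus> v = lam u' \<oplus> v'"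
  shows "u = u' \<and> v = v'"
proof -
  have ind: "indecomposable (lam u)" "indecomposable (lam u')"
    using assms by (auto simp: indecomposable_def)
  have dec: "decomposable (lam a \<oplus> b)" if "a \<in> carrier" "b \<in> carrier" "b \<noteq> e" for a b
    using that by (auto simp: decomposable_def indecomposable_def)
  have nd: "\<not> decomposable (lam a)" if "a \<in> carrier" for a
    using that indecomposable_not_decomposable indecomposable_def by blast
  consider "v = e" "v' = e" | "v = e" "v' \<noteq> e" | "v \<noteq> e" "v' = e" | "v \<noteq> e" "v' \<noteq> e"
    by blast
  then show ?thesis
  proof cases
    case 1
    then show ?thesis
      using assms indecomposable_unique lam_carrier oplus_e_right by metis
  next
    case 2
    then show ?thesis
      using assms dec[of u' v'] nd[of u] lam_carrier oplus_e_right by metis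
  next
    case 3
    then show ?thesis
      using assms dec[of u v] nd[of u'] lam_carrier oplus_e_right by metis
  next
    case 4
    then show ?thesis
      using assms ind indecomposable_unique decomposable_unique by metis
  qed
qed

lemma ominus_graph_closed: "ominus_graph t v w \<Longrightarrow> t \<in> carrier \<and> v \<in> carrier \<and> w \<in> carrier"
  by (induction rule: ominus_graph.induct) (auto intro: e_carrier lam_carrier oplus_carrier)

lemma ominus_graph_e: "ominus_graph e v w \<Longrightarrow> w = v"
  by (cases rule: ominus_graph.cases) (auto dest: lam_neq_e oplus_eq_e)

lemma oplus_nonempty_form:
  assumes "t \<in> carrier" "t \<noteq> e" "u \<in> carrier" "u \<noteq> e"
  obtains a b where "a \<in> carrier" "b \<in> carrier" "t = lam a \<oplus> b" "b \<oplus> u \<in> carrier" "b \<oplus> u \<noteq> e"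
    "t \<oplus> u = lam a \<oplus> (b \<oplus> u)"
proof -
  obtain a b where ab: "a \<in> carrier" "b \<in> carrier" "t = lam a \<oplus> b"
    using nonempty_form assms by blast
  then show ?thesis
    using that assms oplus_assoc lam_carrier oplus_carrier oplus_eq_e by metis
qed

lemma ominus_graph_lam:
  assumes "ominus_graph (lam s) v w" "s \<in> carrier"
  obtains w' where "ominus_graph s v w'" "w = lam w'"
  using assms(1)
proof (cases rule: ominus_graph.cases)
  case og_e
  then show ?thesis using lam_neq_e assms by metis
next
  case (og_lam u w')
  then show ?thesis using that indecomposable_unique assms by metis
next
  case (og_oplus t u w')
  then obtain a b where ab: "a \<in> carrier" "b \<oplus> u \<in> carrier" "b \<oplus> u \<noteq> e"
      "lam s \<oplus> e = lam a \<oplus> (b \<oplus> u)"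
    using oplus_nonempty_form assms lam_carrier oplus_e_right by metis
  then show ?thesis
    using nonempty_form_unique[of s e a "b \<oplus> u"] assms e_carrier by metis
qed

lemma ominus_graph_decomp:
  assumes "ominus_graph (lam a \<oplus> b) v w" "a \<in> carrier" "b \<in> carrier" "b \<noteq> e"
  obtains w' where "ominus_graph b v w'" "w = lam a \<oplus> w'"
  using assms(1)
proof (cases rule: ominus_graph.cases)
  case og_e
  then show ?thesis using oplus_eq_e assms lam_carrier by metis
next
  case (og_lam u w')
  then show ?thesis
    using nonempty_form_unique[of a b u e] assms e_carrier lam_carrier oplus_e_right by metis
next
  case (og_oplus t u w')
  obtain c d where cd: "c \<in> carrier" "d \<in> carrier" "t = lam c \<oplus> d" "d \<oplus> u \<in> carrier"
      "t \<oplus> u = lam c \<oplus> (d \<oplus> u)"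
    using oplus_nonempty_form og_oplus by metis
  have *: "a = c" "b = d \<oplus> u"
    using nonempty_form_unique[of a b c "d \<oplus> u"] assms cd og_oplus(1) by metis+
  have w': "w' \<in> carrier"
    using ominus_graph_closed og_oplus by blast
  have "ominus_graph b v (d \<oplus> w')"
  proof (cases "d = e")
    case True
    then show ?thesis using * og_oplus w' oplus_e_left by simp
  next
    case False
    then show ?thesis using * og_oplus cd ominus_graph.og_oplus by metis
  qed
  moreover have "w = lam a \<oplus> (d \<oplus> w')"
    using * cd w' og_oplus oplus_assoc lam_carrier by metis
  ultimately show ?thesis using that by blast
qed

lemma ominus_graph_ex1:
  assumes "t \<in> carrier" "v \<in> carrier"
  shows "\<exists>!w. ominus_graph t v w"
proof -
  have "t \<in> C n \<Longrightarrow> \<exists>!w. ominus_graph t v w" for n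
  proof (induction n arbitrary: t rule: less_induct)
    case (less n)
    show ?case
    proof (cases "t = e")
      case True
      then show ?thesis
        using og_e[OF assms(2)] ominus_graph_e by blast
    next
      case False
      obtain a b where ab: "a \<in> carrier" "b \<in> carrier" "t = lam a \<oplus> b"
        using False less.prems carrierI nonempty_form by metis
      obtain i j where ij: "a \<in> C i" "b \<in> C j"
        using ab carrierE by metis
      have n: "n = Suc i + j"
        using ab ij less.prems lam_closed oplus_closed size_unique by metis
      obtain x where x: "ominus_graph a v x" "\<And>w. ominus_graph a v w \<Longrightarrow> w = x"
        using less.IH[of i a] n ij by auto
      show ?thesis
      proof (cases "b = e")
        case True
        then have t: "t = lam a"
          using ab lam_carrier oplus_e_right by metis
        show ?thesis
        proof (rule ex1I)
          show "ominus_graph t v (lam x)"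
            using t x ab assms og_lam by blast
          show "w = lam x" if "ominus_graph t v w" for w
            using that t x ab ominus_graph_lam by metis
        qed
      next
        case False
        obtain y where y: "ominus_graph b v y" "\<And>w. ominus_graph b v w \<Longrightarrow> w = y"
          using less.IH[of j b] n ij by auto
        show ?thesis
        proof (rule ex1I)
          show "ominus_graph t v (lam a \<oplus> y)"
            using ab assms y False og_oplus lam_carrier lam_neq_e by metis
          show "w = lam a \<oplus> y" if "ominus_graph t v w" for w
            using that ab y False ominus_graph_decomp by metis
        qed
      qed
    qed
  qed
  then show ?thesis
    using assms carrierE by metis
qed

lemma ominus_graph_iff:
  assumes "t \<in> carrier" "v \<in> carrier"
  shows "ominus_graph t v w \<longleftrightarrow> t \<ominus> v = w"
  unfolding ominus_def using ominus_graph_ex1[OF assms] theI'[OF ominus_graph_ex1[OF assms]] by blast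

lemma ominus_carrier: "t \<in> carrier \<Longrightarrow> v \<in> carrier \<Longrightarrow> t \<ominus> v \<in> carrier"
  using ominus_graph_closed ominus_graph_iff by blast

theorem ominus_e: "v \<in> carrier \<Longrightarrow> e \<ominus> v = v"
  using ominus_graph_iff og_e e_carrier by blast

theorem ominus_lam: "u \<in> carrier \<Longrightarrow> v \<in> carrier \<Longrightarrow> lam u \<ominus> v = lam (u \<ominus> v)"
  using ominus_graph_iff og_lam lam_carrier by blast

theorem ominus_oplus:
  "\<lbrakk>t \<in> carrier; t \<noteq> e; u \<in> carrier; u \<noteq> e; v \<in> carrier\<rbrakk> \<Longrightarrow> (t \<oplus> u) \<ominus> v = t \<oplus> (u \<ominus> v)"
  using og_oplus[of t u v "u \<ominus> v"] ominus_graph_iff[of u v "u \<ominus> v"]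
    ominus_graph_iff[of "t \<oplus> u" v] oplus_carrier by simp

lemma gamma_carrier: "t \<in> carrier \<Longrightarrow> gamma t \<in> carrier"
  unfolding gamma_def using oplus_carrier lam_carrier e_carrier by blast

lemma h_graph_closed: "h_graph t t' \<Longrightarrow> t \<in> carrier \<and> t' \<in> carrier"
  by (induction rule: h_graph.induct)
    (auto intro: e_carrier lam_carrier oplus_carrier ominus_carrier gamma_carrier)

lemma lam_oplus_neq_e: "u \<in> carrier \<Longrightarrow> v \<in> carrier \<Longrightarrow> lam u \<oplus> v \<noteq> e"
  using oplus_eq_e[of "lam u" v] lam_neq_e[of u] lam_carrier oplus_e_right by metis

lemma h_graph_ex1:
  assumes "t \<in> carrier"
  shows "\<exists>!t'. h_graph t t'"
proof -
  have "t \<in> C n \<Longrightarrow> \<exists>!t'. h_graph t t'" for n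
  proof (induction n arbitrary: t rule: less_induct)
    case (less n)
    show ?case
    proof (cases "t = e")
      case True
      show ?thesis
      proof (rule ex1I)
        show "h_graph t e"
          using True hg_e by simp
        show "t' = e" if "h_graph t t'" for t'
          using that True by (cases rule: h_graph.cases) (auto dest: lam_oplus_neq_e)
      qed
    next
      case False
      obtain a b where ab: "a \<in> carrier" "b \<in> carrier" "t = lam a \<oplus> b"
        using False less.prems carrierI nonempty_form by metis
      obtain i j where ij: "a \<in> C i" "b \<in> C j"
        using ab carrierE by metis
      have n: "n = Suc i + j"
        using ab ij less.prems lam_closed oplus_closed size_unique by metis
      obtain x where x: "h_graph a x" "\<And>w. h_graph a w \<Longrightarrow> w = x"
        using less.IH[of i a] n ij by auto
      obtain y where y: "h_graph b y" "\<And>w. h_graph b w \<Longrightarrow> w = y"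
        using less.IH[of j b] n ij by auto
      show ?thesis
      proof (rule ex1I)
        show "h_graph t (y \<ominus> gamma x)"
          using ab x y hg_lam by blast
        show "t' = y \<ominus> gamma x" if "h_graph t t'" for t'
          using that
        proof (cases rule: h_graph.cases)
          case hg_e
          then show ?thesis using False by simp
        next
          case (hg_lam u v u' v')
          then show ?thesis using nonempty_form_unique[of a b u v] ab x y by metis
        qed
      qed
    qed
  qed
  then show ?thesis
    using assms carrierE by metis
qed

lemma h_graph_iff: "t \<in> carrier \<Longrightarrow> h_graph t t' \<longleftrightarrow> h t = t'"
  unfolding h_def using h_graph_ex1 theI'[OF h_graph_ex1] by blast

lemma h_carrier: "t \<in> carrier \<Longrightarrow> h t \<in> carrier"
  using h_graph_closed h_graph_iff by blast

theorem h_e: "h e = e"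
  using h_graph_iff hg_e e_carrier by blast

theorem h_lam_oplus: "u \<in> carrier \<Longrightarrow> v \<in> carrier \<Longrightarrow> h (lam u \<oplus> v) = h v \<ominus> gamma (h u)"
  using hg_lam[of u v "h u" "h v"] h_graph_iff[of u "h u"] h_graph_iff[of v "h v"]
    h_graph_iff[of "lam u \<oplus> v"] oplus_carrier lam_carrier by simp

end

section \<open>Triangulations\<close>

text \<open>
  Edges are unordered pairs of vertex labels, represented as two-element sets. The vertices
  \<open>1, \<dots>, n + 2\<close> are in convex position in this cyclic order, so two segments cross iff their
  endpoints strictly interleave. A triangulation is represented by its set of edges (diagonals
  and boundary edges), which also determines its size. For \<open>n = 0\<close> the polygon degenerates to
  the single edge \<open>{1, 2}\<close>.
\<close>

type_synonym edge_set = "nat set set"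

definition boundary :: "nat \<Rightarrow> edge_set" where
  "boundary n = {{i, i + 1} | i. 1 \<le> i \<and> i \<le> n + 1} \<union> {{1, n + 2}}"

definition diagonals :: "nat \<Rightarrow> edge_set" where
  "diagonals n = {{i, j} | i j. 1 \<le> i \<and> i < j \<and> j \<le> n + 2} - boundary n"

definition crosses :: "nat set \<Rightarrow> nat set \<Rightarrow> bool" where
  "crosses s t \<longleftrightarrow> (\<exists>a b c d. a < c \<and> c < b \<and> b < d \<and>
      (s = {a, b} \<and> t = {c, d} \<or> s = {c, d} \<and> t = {a, b}))"

definition noncrossing :: "edge_set \<Rightarrow> bool" where
  "noncrossing D \<longleftrightarrow> (\<forall>s\<in>D. \<forall>t\<in>D. \<not> crosses s t)"

definition triangulations :: "nat \<Rightarrow> edge_set set" where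
  "triangulations n = {D \<union> boundary n | D. D \<subseteq> diagonals n \<and> noncrossing D \<and>
      (\<forall>D'. D \<subseteq> D' \<and> D' \<subseteq> diagonals n \<and> noncrossing D' \<longrightarrow> D' = D)}"

definition tri_size :: "edge_set \<Rightarrow> nat" where
  "tri_size T = card (\<Union>T) - 2"

lemma Union_boundary: "\<Union>(boundary n) = {1..n + 2}"
proof
  show "\<Union>(boundary n) \<subseteq> {1..n + 2}"
    by (auto simp: boundary_def)
  show "{1..n + 2} \<subseteq> \<Union>(boundary n)"
  proof
    fix i assume "i \<in> {1..n + 2}"
    then have "(1 \<le> i \<and> i \<le> n + 1) \<or> i = n + 2"
      by auto
    then show "i \<in> \<Union>(boundary n)"
      by (auto simp: boundary_def)
  qed
qed

lemma tri_size_triangulation: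
  assumes "T \<in> triangulations n"
  shows "tri_size T = n"
proof -
  obtain D where D: "T = D \<union> boundary n" "D \<subseteq> diagonals n"
    using assms by (auto simp: triangulations_def)
  have "\<Union>(diagonals n) \<subseteq> {1..n + 2}"
    by (auto simp: diagonals_def)
  then have "\<Union>T = {1..n + 2}"
    using D Union_boundary by auto
  then show ?thesis
    by (simp add: tri_size_def)
qed

definition relabel :: "(nat \<Rightarrow> nat) \<Rightarrow> edge_set \<Rightarrow> edge_set" where
  "relabel f T = (\<lambda>s. f ` s) ` T"

definition tri_e :: edge_set where
  "tri_e = {{1, 2}}"

definition tri_lam :: "edge_set \<Rightarrow> edge_set" where
  "tri_lam T = relabel (\<lambda>i. i + 1) T \<union> {{1, 2}, {1, tri_size T + 3}}"

definition tri_oplus :: "edge_set \<Rightarrow> edge_set \<Rightarrow> edge_set" where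
  "tri_oplus T1 T2 = T1 \<union> relabel (\<lambda>j. if j = 1 then 1 else tri_size T1 + j) T2"

interpretation tri: catalan_signature triangulations tri_e tri_lam tri_oplus .

end

theory Submission
  imports Defs
begin

text \<open>A triangulation of size \<open>n \<ge> 1\<close> has a unique triangle \<open>(1, 2, k)\<close> on the edge \<open>(1, 2)\<close>, and
  cutting along its other two sides writes it uniquely as \<open>\<lambda>(u) \<oplus> v\<close>. For \<open>s\<close> of size \<open>m\<close> and \<open>v\<close>
  of size \<open>n\<close>, \<open>s \<ominus> v\<close> is obtained by gluing the edge \<open>(1, n + 2)\<close> of \<open>v\<close> onto the edge
  \<open>(m + 1, m + 2)\<close> of \<open>s\<close>. The reflection \<open>i \<mapsto> n + 3 - i\<close> therefore sends \<open>\<lambda>(u) \<oplus> v\<close> to the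
  reflection of \<open>v\<close> with \<open>\<gamma>\<close> of the reflection of \<open>u\<close> glued to its last edge, which is the
  recursion for \<open>h\<close>.\<close>

section \<open>Maximal non-crossing edge sets\<close>

definition edges_on :: "nat set \<Rightarrow> edge_set" where
  "edges_on V = {{i, j} | i j. i \<in> V \<and> j \<in> V \<and> i < j}"

text \<open>For \<open>V = {1..n + 2}\<close> these are the triangulations of size \<open>n\<close>: boundary edges cross nothing,
  so maximality puts them into \<open>T\<close>.\<close>

definition polytri :: "nat set \<Rightarrow> edge_set \<Rightarrow> bool" where
  "polytri V T \<longleftrightarrow> T \<subseteq> edges_on V \<and> noncrossing T \<and>
    (\<forall>s\<in>edges_on V. (\<forall>t\<in>T. \<not> crosses s t) \<longrightarrow> s \<in> T)"

lemma crosses_sym: "crosses s t \<longleftrightarrow> crosses t s"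
  unfolding crosses_def by blast

lemma crosses_pair:
  assumes "i < j" "k < l"
  shows "crosses {i, j} {k, l} \<longleftrightarrow> i < k \<and> k < j \<and> j < l \<or> k < i \<and> i < l \<and> l < j"
  using assms unfolding crosses_def by (fastforce simp: doubleton_eq_iff)

lemma edges_onE:
  assumes "s \<in> edges_on V"
  obtains i j where "s = {i, j}" "i \<in> V" "j \<in> V" "i < j"
  using assms unfolding edges_on_def by blast

lemma edges_onI: "i \<in> V \<Longrightarrow> j \<in> V \<Longrightarrow> i < j \<Longrightarrow> {i, j} \<in> edges_on V"
  unfolding edges_on_def by blast

lemma edges_on_mono: "V \<subseteq> W \<Longrightarrow> edges_on V \<subseteq> edges_on W"
  unfolding edges_on_def by blast

lemma edges_on_restrict: "s \<in> edges_on V \<Longrightarrow> s \<subseteq> W \<Longrightarrow> s \<in> edges_on (V \<inter> W)"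
  by (auto elim!: edges_onE intro!: edges_onI)

lemma edges_on_subset: "s \<in> edges_on V \<Longrightarrow> s \<subseteq> V"
  by (auto elim!: edges_onE)

lemma not_crosses_self: "s \<in> edges_on V \<Longrightarrow> \<not> crosses s s"
  by (auto elim!: edges_onE simp: crosses_pair)

lemma polytriD:
  assumes "polytri V T"
  shows "T \<subseteq> edges_on V" "\<And>s t. s \<in> T \<Longrightarrow> t \<in> T \<Longrightarrow> \<not> crosses s t"
    "\<And>s. s \<in> edges_on V \<Longrightarrow> (\<And>t. t \<in> T \<Longrightarrow> \<not> crosses s t) \<Longrightarrow> s \<in> T"
  using assms unfolding polytri_def noncrossing_def by blast+

lemma polytriI:
  assumes "T \<subseteq> edges_on V" "\<And>s t. s \<in> T \<Longrightarrow> t \<in> T \<Longrightarrow> \<not> crosses s t"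
    "\<And>s. s \<in> edges_on V \<Longrightarrow> (\<And>t. t \<in> T \<Longrightarrow> \<not> crosses s t) \<Longrightarrow> s \<in> T"
  shows "polytri V T"
  using assms unfolding polytri_def noncrossing_def by blast

lemma boundary_edges: "boundary n \<subseteq> edges_on {1..n + 2}"
  unfolding boundary_def by (auto intro!: edges_onI)

text \<open>No vertex lies strictly between \<open>i\<close> and \<open>i + 1\<close>, and none
  outside the range from \<open>1\<close> to \<open>n + 2\<close>, so an endpoint for the
  interleaving is missing.\<close>

lemma boundary_not_crosses:
  assumes "s \<in> boundary n" "t \<in> edges_on {1..n + 2}"
  shows "\<not> crosses s t"
proof -
  obtain k l where t: "t = {k, l}" "k \<in> {1..n + 2}" "l \<in> {1..n + 2}" "k < l"
    using assms edges_onE by metis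
  from assms(1) consider i where "s = {i, i + 1}" | "s = {1, n + 2}"
    unfolding boundary_def by blast
  then show ?thesis
    using t by cases (auto simp: crosses_pair)
qed

lemma diagonals_eq: "diagonals n = edges_on {1..n + 2} - boundary n"
proof -
  have "{{i, j} | i j. 1 \<le> i \<and> i < j \<and> j \<le> n + 2} = edges_on {1..n + 2}"
    unfolding edges_on_def by (intro Collect_cong ex_cong1) auto
  then show ?thesis
    unfolding diagonals_def by simp
qed

text \<open>Maximality under inclusion amounts to containing each single edge that crosses no
  member. In this form it passes to the vertex sets other than \<open>{1..n + 2}\<close> that
  relabelling and cutting produce.\<close>

lemma triangulations_eq: "T \<in> triangulations n \<longleftrightarrow> polytri {1..n + 2} T"
proof
  assume "T \<in> triangulations n"
  then obtain D where D: "T = D \<union> boundary n" "D \<subseteq> diagonals n" "noncrossing D"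
    "\<forall>D'. D \<subseteq> D' \<and> D' \<subseteq> diagonals n \<and> noncrossing D' \<longrightarrow> D' = D"
    unfolding triangulations_def by blast
  have sub: "T \<subseteq> edges_on {1..n + 2}"
    using D(1,2) boundary_edges[of n] unfolding diagonals_eq by blast
  show "polytri {1..n + 2} T"
  proof (rule polytriI)
    fix s t assume "s \<in> T" "t \<in> T"
    then show "\<not> crosses s t"
      using D(1,3) sub boundary_not_crosses[of s n t] boundary_not_crosses[of t n s]
        crosses_sym[of s t]
      unfolding noncrossing_def by blast
  next
    fix s assume s: "s \<in> edges_on {1..n + 2}" "\<And>t. t \<in> T \<Longrightarrow> \<not> crosses s t"
    show "s \<in> T"
    proof (cases "s \<in> boundary n")
      case False
      have "noncrossing (insert s D)"
        using s(2) D(1,3) crosses_sym not_crosses_self[OF s(1)] unfolding noncrossing_def by blast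
      then have "insert s D = D"
        using D(2,4) s(1) False diagonals_eq by (metis DiffI insert_subset subset_insertI)
      then show ?thesis
        using D(1) by blast
    qed (use D(1) in blast)
  qed (rule sub)
next
  assume T: "polytri {1..n + 2} T"
  note T = polytriD[OF this]
  have bd: "boundary n \<subseteq> T"
    using T(1,3) boundary_edges[of n] boundary_not_crosses[of _ n] by (meson subset_eq)
  define D where "D = T - boundary n"
  have "D' = D" if D': "D \<subseteq> D'" "D' \<subseteq> diagonals n" "noncrossing D'" for D'
  proof
    show "D' \<subseteq> D"
    proof
      fix s assume s: "s \<in> D'"
      then have s': "s \<in> edges_on {1..n + 2}" "s \<notin> boundary n"
        using D'(2) unfolding diagonals_eq by blast+
      have "\<not> crosses s t" if "t \<in> T" for t
      proof (cases "t \<in> boundary n")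
        case True
        then show ?thesis
          using boundary_not_crosses[OF _ s'(1)] crosses_sym by blast
      next
        case False
        then have "t \<in> D'"
          using that D'(1) unfolding D_def by blast
        then show ?thesis
          using D'(3) s unfolding noncrossing_def by blast
      qed
      then show "s \<in> D"
        using T(3) s' unfolding D_def by blast
    qed
  qed (rule D'(1))
  moreover have "T = D \<union> boundary n" "D \<subseteq> diagonals n" "noncrossing D"
    using bd T(1,2) unfolding D_def noncrossing_def diagonals_eq by blast+
  ultimately show "T \<in> triangulations n"
    unfolding triangulations_def by blast
qed

section \<open>Increasing relabellings\<close>

lemma crosses_relabel:
  assumes "strict_mono_on V f" "s \<in> edges_on V" "t \<in> edges_on V"
  shows "crosses (f ` s) (f ` t) \<longleftrightarrow> crosses s t"
proof -
  obtain i j where s: "s = {i, j}" "i \<in> V" "j \<in> V" "i < j"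
    using assms(2) edges_onE by metis
  obtain k l where t: "t = {k, l}" "k \<in> V" "l \<in> V" "k < l"
    using assms(3) edges_onE by metis
  have "f x < f y \<longleftrightarrow> x < y" if "x \<in> V" "y \<in> V" for x y
    using strict_mono_on_less[OF assms(1)] that by blast
  then show ?thesis
    using s t by (simp add: crosses_pair)
qed

lemma relabel_edges_on:
  assumes "strict_mono_on V f"
  shows "relabel f (edges_on V) = edges_on (f ` V)"
proof
  show "relabel f (edges_on V) \<subseteq> edges_on (f ` V)"
    using assms unfolding relabel_def
    by (auto elim!: edges_onE intro!: edges_onI dest: strict_mono_onD)
  show "edges_on (f ` V) \<subseteq> relabel f (edges_on V)"
  proof
    fix s assume "s \<in> edges_on (f ` V)"
    then obtain i j where "s = {f i, f j}" "i \<in> V" "j \<in> V" "f i < f j"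
      by (auto elim!: edges_onE)
    then have "s = f ` {i, j}" "{i, j} \<in> edges_on V"
      using strict_mono_on_less[OF assms] by (auto intro: edges_onI)
    then show "s \<in> relabel f (edges_on V)"
      unfolding relabel_def by blast
  qed
qed

text \<open>Crossing depends only on the order of the endpoints, and a strictly increasing map
  carries the edges on \<open>V\<close> onto the edges on its image.\<close>

lemma polytri_relabel:
  assumes "polytri V T" "strict_mono_on V f"
  shows "polytri (f ` V) (relabel f T)"
proof (rule polytriI)
  note T = polytriD[OF assms(1)]
  show "relabel f T \<subseteq> edges_on (f ` V)"
    using T(1) relabel_edges_on[OF assms(2)] unfolding relabel_def by blast
  show "\<not> crosses s t" if "s \<in> relabel f T" "t \<in> relabel f T" for s t
    using that T(1,2) crosses_relabel[OF assms(2)] unfolding relabel_def by blast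
  fix s assume s: "s \<in> edges_on (f ` V)" "\<And>t. t \<in> relabel f T \<Longrightarrow> \<not> crosses s t"
  then obtain r where r: "r \<in> edges_on V" "s = f ` r"
    unfolding relabel_edges_on[OF assms(2), symmetric] relabel_def by blast
  have "\<not> crosses r t" if "t \<in> T" for t
    using that r s(2)[of "f ` t"] T(1) crosses_relabel[OF assms(2)] unfolding relabel_def by blast
  then show "s \<in> relabel f T"
    using r T(3) unfolding relabel_def by blast
qed

section \<open>Cutting and gluing along a chord\<close>

lemma polytri_extremal:
  assumes "polytri V T" "p \<in> V" "q \<in> V" "p < q" "V \<subseteq> {p..q}"
  shows "{p, q} \<in> T"
proof (rule polytriD(3)[OF assms(1)])
  fix t assume "t \<in> T"
  then obtain k l where "t = {k, l}" "k \<in> V" "l \<in> V" "k < l"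
    using polytriD(1)[OF assms(1)] edges_onE by blast
  then show "\<not> crosses {p, q} t"
    using assms(4,5) by (auto simp: crosses_pair)
qed (use assms in \<open>auto intro: edges_onI\<close>)

text \<open>Crossing would place an endpoint of \<open>t\<close> strictly between the endpoints of
  \<open>s\<close>, hence strictly between \<open>p\<close> and \<open>q\<close>.\<close>

lemma not_crosses_separated:
  assumes "s \<in> edges_on V" "t \<in> edges_on V" "s \<subseteq> {p..q}" "t \<inter> {p<..<q} = {}"
  shows "\<not> crosses s t"
  using assms by (auto elim!: edges_onE simp: crosses_pair)

lemma chord_separates:
  assumes "s \<in> edges_on V" "p < q" "\<not> crosses s {p, q}"
  shows "s \<subseteq> {p..q} \<or> s \<inter> {p<..<q} = {}"
  using assms by (auto elim!: edges_onE simp: crosses_pair)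

text \<open>Edges on different sides of the chord never cross. An edge that crosses no member of the
  union does not cross the chord either, so it stays on one side, where the maximality of that part
  applies.\<close>

lemma polytri_glue:
  assumes "polytri A S" "polytri B R" "{p, q} \<in> S" "{p, q} \<in> R" "p < q"
    "A \<subseteq> {p..q}" "B \<inter> {p<..<q} = {}"
  shows "polytri (A \<union> B) (S \<union> R)"
proof (rule polytriI)
  note S = polytriD[OF assms(1)] and R = polytriD[OF assms(2)]
  show sub: "S \<union> R \<subseteq> edges_on (A \<union> B)"
    using S(1) R(1) edges_on_mono[of A "A \<union> B"] edges_on_mono[of B "A \<union> B"] by blast
  have *: "\<not> crosses s r" if "s \<in> S" "r \<in> R" for s r
  proof (rule not_crosses_separated)
    show "s \<subseteq> {p..q}" "r \<inter> {p<..<q} = {}"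
      using that S(1) R(1) edges_on_subset assms(6,7) by blast+
  qed (use that sub in auto)
  show "\<not> crosses s t" if "s \<in> S \<union> R" "t \<in> S \<union> R" for s t
    using that * crosses_sym S(2) R(2) by blast
  fix s assume s: "s \<in> edges_on (A \<union> B)" "\<And>t. t \<in> S \<union> R \<Longrightarrow> \<not> crosses s t"
  have pq: "p \<in> A" "q \<in> A" "p \<in> B" "q \<in> B"
    using assms(3,4) S(1) R(1) edges_on_subset by blast+
  have "s \<subseteq> A \<or> s \<subseteq> B"
  proof -
    have "s \<subseteq> {p..q} \<or> s \<inter> {p<..<q} = {}"
      using chord_separates[OF s(1) assms(5)] s(2) assms(3) by blast
    moreover have "s \<subseteq> A" if "s \<subseteq> {p..q}"
    proof
      fix x assume "x \<in> s"
      then have "x \<in> A \<union> B" "x \<in> {p..q}"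
        using that edges_on_subset[OF s(1)] by blast+
      \<comment> \<open>\<open>B\<close> meets \<open>{p..q}\<close> only in the ends of the chord,
        and these also lie in \<open>A\<close>.\<close>
      moreover have "x = p \<or> x = q" if "x \<in> B" "x \<in> {p..q}"
        using that assms(7) by fastforce
      ultimately show "x \<in> A"
        using pq by blast
    qed
    moreover have "s \<subseteq> B" if out: "s \<inter> {p<..<q} = {}"
    proof
      fix x assume x: "x \<in> s"
      then have "x \<in> A \<union> B" "x \<notin> {p<..<q}"
        using out edges_on_subset[OF s(1)] by blast+
      moreover have "x = p \<or> x = q" if "x \<in> A" "x \<notin> {p<..<q}"
        using that assms(6) by fastforce
      ultimately show "x \<in> B"
        using pq by blast
    qed
    ultimately show ?thesis
      by blast
  qed
  then have "s \<in> edges_on A \<or> s \<in> edges_on B"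
    using edges_on_restrict[OF s(1), of A] edges_on_restrict[OF s(1), of B]
    by (auto simp: Int_Un_distrib2 Int_absorb1)
  then show "s \<in> S \<union> R"
    using S(3) R(3) s(2) by blast
qed

text \<open>An edge on one side that crosses nothing there crosses nothing in \<open>T\<close>,
  because edges on opposite sides of the chord never cross. So each side inherits
  maximality.\<close>

lemma polytri_split:
  assumes "polytri V T" "{p, q} \<in> T" "p < q"
  shows "polytri (V \<inter> {p..q}) {t \<in> T. t \<subseteq> {p..q}}"
    and "polytri (V - {p<..<q}) {t \<in> T. t \<inter> {p<..<q} = {}}"
    and "T = {t \<in> T. t \<subseteq> {p..q}} \<union> {t \<in> T. t \<inter> {p<..<q} = {}}"
proof -
  note T = polytriD[OF assms(1)]
  show split: "T = {t \<in> T. t \<subseteq> {p..q}} \<union> {t \<in> T. t \<inter> {p<..<q} = {}}"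
    using chord_separates assms(2,3) T(1,2) by blast
  show "polytri (V \<inter> {p..q}) {t \<in> T. t \<subseteq> {p..q}}"
  proof (rule polytriI)
    show "{t \<in> T. t \<subseteq> {p..q}} \<subseteq> edges_on (V \<inter> {p..q})"
      using T(1) edges_on_restrict by blast
    fix s assume s: "s \<in> edges_on (V \<inter> {p..q})"
      "\<And>t. t \<in> {t \<in> T. t \<subseteq> {p..q}} \<Longrightarrow> \<not> crosses s t"
    have s': "s \<in> edges_on V" "s \<subseteq> {p..q}"
      using s(1) edges_on_mono edges_on_subset by blast+
    have "\<not> crosses s t" if "t \<in> T" for t
    proof (cases "t \<subseteq> {p..q}")
      case True
      then show ?thesis using that s(2) by simp
    next
      case False
      then have "t \<inter> {p<..<q} = {}"
        using that split by auto
      then show ?thesis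
        using not_crosses_separated[OF s'(1) _ s'(2)] that T(1) by blast
    qed
    then show "s \<in> {t \<in> T. t \<subseteq> {p..q}}"
      using T(3) s' by blast
  qed (use T(2) in blast)
  show "polytri (V - {p<..<q}) {t \<in> T. t \<inter> {p<..<q} = {}}"
  proof (rule polytriI)
    show "{t \<in> T. t \<inter> {p<..<q} = {}} \<subseteq> edges_on (V - {p<..<q})"
      using T(1) edges_on_restrict[of _ V "- {p<..<q}"] unfolding Diff_eq by blast
    fix s assume s: "s \<in> edges_on (V - {p<..<q})"
      "\<And>t. t \<in> {t \<in> T. t \<inter> {p<..<q} = {}} \<Longrightarrow> \<not> crosses s t"
    have s': "s \<in> edges_on V" "s \<inter> {p<..<q} = {}"
      using s(1) edges_on_mono[of "V - {p<..<q}" V] edges_on_subset by blast+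
    have "\<not> crosses s t" if "t \<in> T" for t
    proof (cases "t \<inter> {p<..<q} = {}")
      case True
      then show ?thesis using that s(2) by simp
    next
      case False
      then have "t \<subseteq> {p..q}"
        using that split by auto
      then show ?thesis
        using not_crosses_separated[OF _ s'(1) _ s'(2)] that T(1) crosses_sym by blast
    qed
    then show "s \<in> {t \<in> T. t \<inter> {p<..<q} = {}}"
      using T(3) s' by blast
  qed (use T(2) in blast)
qed

section \<open>Triangulations as a Catalan structure\<close>

lemma relabel_cong:
  assumes "\<And>s x. s \<in> T \<Longrightarrow> x \<in> s \<Longrightarrow> f x = g x"
  shows "relabel f T = relabel g T"
  using assms unfolding relabel_def by (auto intro!: image_cong)

lemma relabel_Un: "relabel f (S \<union> T) = relabel f S \<union> relabel f T"
  unfolding relabel_def by blast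

lemma relabel_insert: "relabel f (insert s T) = insert (f ` s) (relabel f T)"
  unfolding relabel_def by blast

lemma relabel_empty: "relabel f {} = {}"
  unfolding relabel_def by blast

lemma relabel_relabel: "relabel f (relabel g T) = relabel (\<lambda>x. f (g x)) T"
  unfolding relabel_def by (simp add: image_image)

lemma relabel_inj:
  assumes "inj_on f V" "S \<subseteq> edges_on V" "T \<subseteq> edges_on V" "relabel f S = relabel f T"
  shows "S = T"
proof -
  have "inj_on (image f) (Pow V)"
    using assms(1) by (rule inj_on_image_Pow)
  moreover have "S \<subseteq> Pow V" "T \<subseteq> Pow V"
    using assms(2,3) edges_on_subset by blast+
  ultimately show ?thesis
    using assms(4) inj_on_image_eq_iff[of "image f" "Pow V" S T] unfolding relabel_def by metis
qed

section \<open>Vertices, boundary edges and the smallest polygons\<close>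

lemma triangulation_edge:
  assumes "T \<in> triangulations n" "s \<in> T"
  obtains i j where "s = {i, j}" "1 \<le> i" "i < j" "j \<le> n + 2"
proof -
  have "s \<in> edges_on {1..n + 2}"
    using assms polytriD(1) unfolding triangulations_eq by blast
  then show thesis
    using that by (auto elim!: edges_onE)
qed

lemma triangulation_vertex:
  "T \<in> triangulations n \<Longrightarrow> s \<in> T \<Longrightarrow> x \<in> s \<Longrightarrow> 1 \<le> x \<and> x \<le> n + 2"
  by (auto elim!: triangulation_edge)

lemma triangulation_last_edge: "T \<in> triangulations n \<Longrightarrow> {1, n + 2} \<in> T"
  unfolding triangulations_eq by (rule polytri_extremal) auto

lemma triangulation_first_edge: "T \<in> triangulations n \<Longrightarrow> {1, 2} \<in> T"
  using triangulations_def boundary_def by (cases n) fastforce+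

lemma polytri_unique:
  assumes "\<And>s t. s \<in> edges_on V \<Longrightarrow> t \<in> edges_on V \<Longrightarrow> \<not> crosses s t"
  shows "polytri V T \<longleftrightarrow> T = edges_on V"
  using assms unfolding polytri_def noncrossing_def by blast

lemma edges_on_2: "a < b \<Longrightarrow> edges_on {a, b} = {{a, b}}"
  unfolding edges_on_def by auto

lemma edges_on_3: "a < b \<Longrightarrow> b < c \<Longrightarrow> edges_on {a, b, c} = {{a, b}, {a, c}, {b, c}}"
  unfolding edges_on_def by fastforce

lemma polytri_2: "a < b \<Longrightarrow> polytri {a, b} T \<longleftrightarrow> T = {{a, b}}"
  using polytri_unique[of "{a, b}"] by (simp add: edges_on_2 crosses_pair)

lemma polytri_3:
  assumes "a < b" "b < c"
  shows "polytri {a, b, c} T \<longleftrightarrow> T = {{a, b}, {a, c}, {b, c}}"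
proof -
  have "\<not> crosses s t" if "s \<in> edges_on {a, b, c}" "t \<in> edges_on {a, b, c}" for s t
    using that assms unfolding edges_on_3[OF assms] by (auto simp: crosses_pair)
  then show ?thesis
    unfolding edges_on_3[OF assms, symmetric] by (rule polytri_unique)
qed

lemma triangulations_0: "triangulations 0 = {tri_e}"
proof -
  have "{1..0 + 2::nat} = {1, 2}"
    by auto
  then show ?thesis
    using polytri_2[of 1 2] triangulations_eq[of _ 0] unfolding tri_e_def by auto
qed

section \<open>Closure under the two operations\<close>

lemma tri_lam_eq:
  assumes "T \<in> triangulations n"
  shows "tri_lam T = relabel (\<lambda>i. i + 1) T \<union> {{1, 2}, {1, n + 3}}"
  using assms by (simp add: tri_lam_def tri_size_triangulation)

lemma tri_oplus_eq:
  assumes "T \<in> triangulations n"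
  shows "tri_oplus T S = T \<union> relabel (\<lambda>j. if j = 1 then 1 else n + j) S"
  unfolding tri_oplus_def tri_size_triangulation[OF assms] ..

text \<open>The triangle on \<open>1\<close>, \<open>2\<close>, \<open>n + 3\<close> is glued to the
  shifted polygon along \<open>{2, n + 3}\<close>. This side is already an edge of the shifted
  polygon, so \<open>tri_lam\<close> adds only the two sides at \<open>1\<close>.\<close>

lemma tri_lam_closed:
  assumes "T \<in> triangulations n"
  shows "tri_lam T \<in> triangulations (Suc n)"
proof -
  have "(\<lambda>i. i + 1) ` {1..n + 2} = {2..n + 3}"
    using image_add_atLeastAtMost'[of 1 1 "n + 2"] by (simp add: numeral_eq_Suc)
  moreover have "strict_mono_on {1..n + 2} (\<lambda>i. i + 1)"
    by (simp add: strict_mono_on_def)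
  ultimately have 1: "polytri {2..n + 3} (relabel (\<lambda>i. i + 1) T)"
    using polytri_relabel assms unfolding triangulations_eq by metis
  have 2: "{2, n + 3} \<in> relabel (\<lambda>i. i + 1) T"
    using polytri_extremal[OF 1] by auto
  have 3: "polytri {1, 2, n + 3} {{1, 2}, {1, n + 3}, {2, n + 3}}"
    by (subst polytri_3) auto
  have "polytri ({2..n + 3} \<union> {1, 2, n + 3})
      (relabel (\<lambda>i. i + 1) T \<union> {{1, 2}, {1, n + 3}, {2, n + 3}})"
    by (rule polytri_glue[OF 1 3 2]) auto
  moreover have "{2..n + 3} \<union> {1, 2, n + 3} = {1..Suc n + 2}"
    by auto
  moreover have "relabel (\<lambda>i. i + 1) T \<union> {{1, 2}, {1, n + 3}, {2, n + 3}} = tri_lam T"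
    using 2 unfolding tri_lam_eq[OF assms] by blast
  ultimately show ?thesis
    unfolding triangulations_eq by simp
qed

text \<open>The labels start at \<open>1\<close> for a reason: if \<open>m > 0\<close>, label
  \<open>0\<close> would go to \<open>m\<close>, which is not below the image of
  \<open>1\<close>.\<close>

lemma oplus_relabel_strict_mono:
  "strict_mono_on {1..n} (\<lambda>j. if j = 1 then 1 else m + j :: nat)"
  by (auto simp: strict_mono_on_def)

lemma oplus_relabel_image:
  fixes m n :: nat
  shows "(\<lambda>j. if j = 1 then 1 else m + j) ` {1..n + 2} = insert 1 {m + 2..m + n + 2}" (is "?f ` _ = _")
proof -
  have "?f ` {1..n + 2} = ?f ` (insert 1 {2..n + 2})"
    by (rule arg_cong[of _ _ "image ?f"]) auto
  also have "\<dots> = insert 1 (?f ` {2..n + 2})"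
    unfolding image_insert by simp
  also have "?f ` {2..n + 2} = (+) m ` {2..n + 2}"
    by (rule image_cong) auto
  finally show ?thesis
    by (simp add: ac_simps)
qed

text \<open>Both pieces contain the chord \<open>{1, m + 2}\<close>: it is the last edge of
  \<open>S\<close> and the image of the first edge of \<open>T\<close>.\<close>

lemma tri_oplus_closed:
  assumes "S \<in> triangulations m" "T \<in> triangulations n"
  shows "tri_oplus S T \<in> triangulations (m + n)"
proof -
  let ?f = "\<lambda>j. if j = 1 then 1 else m + j"
  have 1: "polytri {1..m + 2} S"
    using assms(1) triangulations_eq by blast
  have 2: "polytri (insert 1 {m + 2..m + n + 2}) (relabel ?f T)"
    using polytri_relabel[OF _ oplus_relabel_strict_mono] assms(2)
    unfolding triangulations_eq oplus_relabel_image[symmetric] by blast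
  have 3: "{1, m + 2} \<in> relabel ?f T"
    using triangulation_first_edge[OF assms(2)] unfolding relabel_def
    by (auto intro!: image_eqI[of _ _ "{1, 2}"])
  have "polytri ({1..m + 2} \<union> insert 1 {m + 2..m + n + 2}) (S \<union> relabel ?f T)"
    by (rule polytri_glue[OF 1 2 triangulation_last_edge[OF assms(1)] 3]) auto
  moreover have "{1..m + 2} \<union> insert 1 {m + 2..m + n + 2} = {1..m + n + 2}"
    by auto
  ultimately show ?thesis
    unfolding triangulations_eq tri_oplus_eq[OF assms(1)] by simp
qed

section \<open>The triangle on the first edge and the unique decomposition\<close>

lemma lam_oplus_eq:
  assumes "u \<in> triangulations a"
  shows "tri_oplus (tri_lam u) v = relabel (\<lambda>i. i + 1) u \<union> {{1, 2}, {1, a + 3}} \<union>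
    relabel (\<lambda>j. if j = 1 then 1 else a + 1 + j) v"
  using tri_oplus_eq[OF tri_lam_closed[OF assms], of v]
  unfolding tri_lam_eq[OF assms] Suc_eq_plus1 .

lemma triangulation_decompose:
  assumes "T \<in> triangulations n" "n \<noteq> 0"
  obtains a b u v where "u \<in> triangulations a" "v \<in> triangulations b" "n = a + b + 1"
    "T = tri_oplus (tri_lam u) v"
proof -
  have poly: "polytri {1..n + 2} T"
    using assms(1) triangulations_eq by blast
  note T = polytriD[OF poly]
  \<comment> \<open>The third vertex of the triangle on \<open>{1, 2}\<close> is the first neighbour of \<open>1\<close> after \<open>2\<close>: an edge
    crossing \<open>{2, k}\<close> would cross \<open>{1, k}\<close> or give \<open>1\<close> an earlier neighbour.\<close>
  define k where "k = (LEAST k. 3 \<le> k \<and> {1, k} \<in> T)"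
  have "3 \<le> k \<and> {1, k} \<in> T"
    unfolding k_def
    by (rule LeastI[of _ "n + 2"]) (use assms triangulation_last_edge in auto)
  then have k: "3 \<le> k" "{1, k} \<in> T"
    by blast+
  have least: "k \<le> d" if "3 \<le> d" "{1, d} \<in> T" for d
    unfolding k_def using that by (intro Least_le) blast
  have kn: "k \<le> n + 2"
    using triangulation_vertex[OF assms(1) k(2), of k] by simp
  have 2: "{2, k} \<in> T"
  proof (rule T(3))
    fix t assume t: "t \<in> T"
    obtain c d where cd: "t = {c, d}" "1 \<le> c" "c < d" "d \<le> n + 2"
      using triangulation_edge[OF assms(1) t] by blast
    have "k \<le> d" if "c = 1" "2 < d"
      using least[of d] that t cd(1) by simp
    moreover have "\<not> crosses {1, k} {c, d}"
      using T(2)[OF k(2) t] cd(1) by simp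
    ultimately show "\<not> crosses {2, k} t"
      using k(1) cd by (auto simp: crosses_pair)
  qed (use k(1) kn in \<open>auto intro!: edges_onI\<close>)
  \<comment> \<open>\<open>u\<close> will occupy the \<open>a + 2\<close> vertices from
    \<open>2\<close> to \<open>k\<close>, and \<open>v\<close> the \<open>b + 2\<close> vertices
    consisting of \<open>1\<close> and those from \<open>k\<close> to \<open>n + 2\<close>.\<close>
  define a b where "a = k - 3" and "b = n + 2 - k"
  have ka: "k = a + 3" and nb: "n = a + b + 1"
    using k(1) kn unfolding a_def b_def by auto
  \<comment> \<open>The chord \<open>{1, k}\<close> separates \<open>A\<close> from
    \<open>B\<close>, which becomes \<open>v\<close>. Inside \<open>A\<close> the chord
    \<open>{2, k}\<close> separates \<open>U\<close>, which becomes \<open>u\<close>, from the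
    triangle.\<close>
  define A where "A = {t \<in> T. t \<subseteq> {1..k}}"
  define B where "B = {t \<in> T. t \<inter> {1<..<k} = {}}"
  define U where "U = {t \<in> A. t \<subseteq> {2..k}}"
  have "1 < k" "2 < k"
    using k(1) by auto
  note split1 = polytri_split[OF poly k(2) \<open>1 < k\<close>, folded A_def B_def]
  have "{1..n + 2} \<inter> {1..k} = {1..k}" "{1..n + 2} - {1<..<k} = insert 1 {k..n + 2}"
    using kn k(1) by auto
  then have A: "polytri {1..k} A" and B: "polytri (insert 1 {k..n + 2}) B" and TAB: "T = A \<union> B"
    using split1 by metis+
  have 2: "{2, k} \<in> A"
    using 2 k(1) unfolding A_def by auto
  note split2 = polytri_split[OF A 2 \<open>2 < k\<close>, folded U_def]
  have V: "{1..k} \<inter> {2..k} = {2..k}" "{1..k} - {2<..<k} = {1, 2, k}"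
    using k(1) by auto
  have U: "polytri {2..k} U"
    using split2(1) unfolding V .
  \<comment> \<open>This part has only the vertices \<open>1\<close>, \<open>2\<close>,
    \<open>k\<close>, so it is the full triangle.\<close>
  have "{t \<in> A. t \<inter> {2<..<k} = {}} = {{1, 2}, {1, k}, {2, k}}"
    using split2(2) polytri_3[OF _ \<open>2 < k\<close>, of 1] unfolding V by simp
  then have AU: "A = U \<union> {{1, 2}, {1, k}, {2, k}}"
    using split2(3) by argo
  define u where "u = relabel (\<lambda>i. i - 1) U"
  define v where "v = relabel (\<lambda>j. if j = 1 then 1 else j - (a + 1)) B"
  have "u \<in> triangulations a"
  proof -
    have "(\<lambda>i. i - 1) ` {2..k} = {1..a + 2}"
      unfolding ka by (auto simp: image_iff intro!: bexI[of _ "Suc _"])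
    moreover have "strict_mono_on {2..k} (\<lambda>i. i - 1)"
      by (auto simp: strict_mono_on_def)
    ultimately show ?thesis
      using polytri_relabel[OF U] unfolding triangulations_eq u_def by metis
  qed
  moreover have "v \<in> triangulations b"
  proof -
    let ?g = "\<lambda>j. if j = 1 then 1 else j - (a + 1)"
    have "x \<in> ?g ` insert 1 {k..n + 2}" if "x \<in> {1..b + 2}" for x
      using that
      by (cases "x = 1") (auto simp: ka nb intro!: image_eqI[of _ _ "x + (a + 1)"])
    then have "?g ` insert 1 {k..n + 2} = {1..b + 2}"
      by (intro equalityI subsetI) (auto simp: ka nb)
    moreover have "strict_mono_on (insert 1 {k..n + 2}) ?g"
      by (auto simp: strict_mono_on_def ka)
    ultimately show ?thesis
      using polytri_relabel[OF B] unfolding triangulations_eq v_def by metis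
  qed
  moreover have "T = tri_oplus (tri_lam u) v"
  proof -
    have id: "relabel (\<lambda>x. x) S = S" for S
      unfolding relabel_def by simp
    \<comment> \<open>Labels in \<open>U\<close> are at least \<open>2\<close>, so adding
      \<open>1\<close> undoes the truncated subtraction.\<close>
    have "relabel (\<lambda>i. i + 1) u = relabel (\<lambda>x. x) U"
      unfolding u_def relabel_relabel
      using polytriD(1)[OF U] edges_on_subset by (intro relabel_cong) fastforce
    then have U': "relabel (\<lambda>i. i + 1) u = U"
      using id by simp
    have "relabel (\<lambda>j. if j = 1 then 1 else a + 1 + j) v = relabel (\<lambda>x. x) B"
      unfolding v_def relabel_relabel
      using polytriD(1)[OF B] edges_on_subset by (intro relabel_cong) (fastforce simp: ka)
    then have B': "relabel (\<lambda>j. if j = 1 then 1 else a + 1 + j) v = B"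
      using id by simp
    \<comment> \<open>\<open>tri_lam\<close> supplies only the sides at \<open>1\<close>; the third
      side of the triangle has to come from \<open>U\<close>.\<close>
    have "{2, k} \<in> U"
      using 2 k(1) unfolding U_def by auto
    then show ?thesis
      unfolding lam_oplus_eq[OF \<open>u \<in> triangulations a\<close>] U' B' TAB AU ka by blast
  qed
  ultimately show thesis
    using that nb by blast
qed

text \<open>Identifies \<open>a + 3\<close> as the third vertex of the triangle on
  \<open>{1, 2}\<close>; its side at \<open>2\<close> is the shifted last edge of
  \<open>u\<close>.\<close>

lemma lam_oplus_apex:
  assumes "u \<in> triangulations a"
  shows "{1, a + 3} \<in> tri_oplus (tri_lam u) v" "{2, a + 3} \<in> tri_oplus (tri_lam u) v"
proof -
  have "(\<lambda>i. i + 1) ` {1, a + 2} \<in> relabel (\<lambda>i. i + 1) u"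
    using triangulation_last_edge[OF assms] unfolding relabel_def by blast
  then show "{2, a + 3} \<in> tri_oplus (tri_lam u) v"
    unfolding lam_oplus_eq[OF assms] by (simp add: numeral_eq_Suc)
qed (simp add: lam_oplus_eq[OF assms])

text \<open>Knowing the apex \<open>a + 3\<close> is enough to recover both factors:
  \<open>u\<close> lives on the labels from \<open>2\<close> to \<open>a + 3\<close>, and
  \<open>v\<close> on \<open>1\<close> and the labels from \<open>a + 3\<close> on.\<close>

lemma lam_oplus_parts:
  assumes "u \<in> triangulations a" "v \<in> triangulations b" "T = tri_oplus (tri_lam u) v"
  shows "{t \<in> T. t \<subseteq> {2..a + 3}} = relabel (\<lambda>i. i + 1) u"
    and "{t \<in> T. t \<inter> {1<..<a + 3} = {}} = relabel (\<lambda>j. if j = 1 then 1 else a + 1 + j) v"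
proof -
  let ?f = "\<lambda>j. if j = 1 then 1 else a + 1 + j"
  have u: "\<exists>i j. t = {i, j} \<and> 2 \<le> i \<and> i < j \<and> j \<le> a + 3"
    if t: "t \<in> relabel (\<lambda>i. i + 1) u" for t
  proof -
    obtain s where s: "s \<in> u" "t = (\<lambda>i. i + 1) ` s"
      using t unfolding relabel_def by blast
    obtain i j where "s = {i, j}" "1 \<le> i" "i < j" "j \<le> a + 2"
      using triangulation_edge[OF assms(1) s(1)] by blast
    then show ?thesis
      using s(2) by (intro exI[of _ "i + 1"] exI[of _ "j + 1"]) auto
  qed
  have v: "\<exists>i j. t = {i, j} \<and> (i = 1 \<or> a + 3 \<le> i) \<and> a + 3 \<le> j \<and> i < j"
    if t: "t \<in> relabel ?f v" for t
  proof -
    obtain s where s: "s \<in> v" "t = ?f ` s"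
      using t unfolding relabel_def by blast
    obtain i j where "s = {i, j}" "1 \<le> i" "i < j" "j \<le> b + 2"
      using triangulation_edge[OF assms(2) s(1)] by blast
    then show ?thesis
      using s(2) by (intro exI[of _ "?f i"] exI[of _ "?f j"]) auto
  qed
  have T: "T = relabel (\<lambda>i. i + 1) u \<union> {{1, 2}, {1, a + 3}} \<union> relabel ?f v"
    unfolding assms(3) lam_oplus_eq[OF assms(1)] ..
  \<comment> \<open>The side \<open>{1, a + 3}\<close> listed by \<open>tri_lam\<close> is also the
    glued first edge of \<open>v\<close>, so it belongs to the second part.\<close>
  have "?f ` {1, 2} \<in> relabel ?f v"
    using triangulation_first_edge[OF assms(2)] unfolding relabel_def by blast
  then have apex: "{1, a + 3} \<in> relabel ?f v"
    by (simp add: numeral_eq_Suc insert_commute)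
  show "{t \<in> T. t \<subseteq> {2..a + 3}} = relabel (\<lambda>i. i + 1) u"
  proof (intro equalityI subsetI)
    fix t assume "t \<in> {t \<in> T. t \<subseteq> {2..a + 3}}"
    then have t: "t \<in> T" "t \<subseteq> {2..a + 3}"
      by auto
    have "t \<notin> relabel ?f v"
    proof
      assume "t \<in> relabel ?f v"
      from v[OF this] t(2) show False
        by auto
    qed
    moreover have "t \<noteq> {1, 2}" "t \<noteq> {1, a + 3}"
      using t(2) by auto
    ultimately show "t \<in> relabel (\<lambda>i. i + 1) u"
      using t(1) unfolding T by blast
  next
    fix t assume t: "t \<in> relabel (\<lambda>i. i + 1) u"
    show "t \<in> {t \<in> T. t \<subseteq> {2..a + 3}}"
      using u[OF t] t unfolding T by auto
  qed
  show "{t \<in> T. t \<inter> {1<..<a + 3} = {}} = relabel ?f v"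
  proof (intro equalityI subsetI)
    fix t assume "t \<in> {t \<in> T. t \<inter> {1<..<a + 3} = {}}"
    then have t: "t \<in> T" "t \<inter> {1<..<a + 3} = {}"
      by auto
    have "t \<notin> relabel (\<lambda>i. i + 1) u"
    proof
      assume "t \<in> relabel (\<lambda>i. i + 1) u"
      from u[OF this] t(2) show False
        by auto
    qed
    moreover have "2 \<in> {1<..<a + 3}"
      by simp
    then have "t \<noteq> {1, 2}"
      using t(2) by blast
    ultimately show "t \<in> relabel ?f v"
      using t(1) apex unfolding T by blast
  next
    fix t assume t: "t \<in> relabel ?f v"
    show "t \<in> {t \<in> T. t \<inter> {1<..<a + 3} = {}}"
    proof -
      obtain i j where "t = {i, j}" "i = 1 \<or> a + 3 \<le> i" "a + 3 \<le> j"
        using v[OF t] by blast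
      then have "t \<inter> {1<..<a + 3} = {}"
        by auto
      then show ?thesis
        using t unfolding T by blast
    qed
  qed
qed

text \<open>With different apexes, the side at \<open>1\<close> of one triangle would cross the side
  at \<open>2\<close> of the other. Once the apex is fixed, cutting the common edge set recovers the
  factors.\<close>

lemma lam_oplus_unique:
  assumes "u \<in> triangulations a" "v \<in> triangulations b"
    "u' \<in> triangulations a'" "v' \<in> triangulations b'"
    "tri_oplus (tri_lam u) v = tri_oplus (tri_lam u') v'"
  shows "u = u'" "v = v'"
proof -
  define T where "T = tri_oplus (tri_lam u) v"
  have T': "T = tri_oplus (tri_lam u') v'"
    using assms(5) T_def by simp
  have tri: "T \<in> triangulations (Suc a + b)" "T \<in> triangulations (Suc a' + b')"
    unfolding T_def by (intro tri_oplus_closed tri_lam_closed assms)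
      (unfold assms(5), intro tri_oplus_closed tri_lam_closed assms)
  \<comment> \<open>\<open>a < a'\<close> would contradict the first statement and
    \<open>a' < a\<close> the second.\<close>
  have "\<not> crosses {1, a + 3} {2, a' + 3}" "\<not> crosses {1, a' + 3} {2, a + 3}"
    using lam_oplus_apex[OF assms(1), of v] lam_oplus_apex[OF assms(3), of v']
      polytriD(2)[OF iffD1[OF triangulations_eq tri(1)]]
    unfolding T_def[symmetric] T'[symmetric] by blast+
  then have a: "a' = a"
    by (auto simp: crosses_pair)
  have b: "b' = b"
    using tri tri_size_triangulation a by (metis add_left_cancel)
  have sub: "S \<subseteq> edges_on {1..m + 2}" if "S \<in> triangulations m" for S m
    using that polytriD(1) triangulations_eq by blast
  have "relabel (\<lambda>i. i + 1) u = relabel (\<lambda>i. i + 1) u'"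
    using lam_oplus_parts(1)[OF assms(1,2) T_def] lam_oplus_parts(1)[OF assms(3,4) T']
    unfolding a by simp
  then show "u = u'"
    by (rule relabel_inj[rotated -1, where V = "{1..a + 2}"])
      (use sub assms(1,3) a in \<open>auto simp: inj_on_def\<close>)
  have "relabel (\<lambda>j. if j = 1 then 1 else a + 1 + j) v =
      relabel (\<lambda>j. if j = 1 then 1 else a + 1 + j) v'"
    using lam_oplus_parts(2)[OF assms(1,2) T_def] lam_oplus_parts(2)[OF assms(3,4) T']
    unfolding a by simp
  then show "v = v'"
    by (rule relabel_inj[rotated -1, where V = "{1..b + 2}"])
      (use sub assms(2,4) b in \<open>auto simp: inj_on_def\<close>)
qed

section \<open>Verification of the Catalan axioms\<close>

lemma tri_oplus_assoc:
  assumes "R \<in> triangulations l" "S \<in> triangulations m" "T \<in> triangulations n"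
  shows "tri_oplus (tri_oplus R S) T = tri_oplus R (tri_oplus S T)"
proof -
  \<comment> \<open>Labels other than \<open>1\<close> are at least \<open>2\<close>, so
    \<open>m + x\<close> is never \<open>1\<close> for them and the nested case distinction
    collapses.\<close>
  have "relabel (\<lambda>j. if j = 1 then 1 else l + m + j) T =
      relabel (\<lambda>x. if (if x = 1 then 1 else m + x) = 1 then 1
        else l + (if x = 1 then 1 else m + x)) T"
    by (rule relabel_cong) (auto dest: triangulation_vertex[OF assms(3)])
  moreover have "tri_oplus (tri_oplus R S) T =
      tri_oplus R S \<union> relabel (\<lambda>j. if j = 1 then 1 else l + m + j) T"
    by (rule tri_oplus_eq[OF tri_oplus_closed[OF assms(1,2)]])
  ultimately show ?thesis
    unfolding tri_oplus_eq[OF assms(1)] tri_oplus_eq[OF assms(2)] relabel_Un relabel_relabel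
    by (simp only: Un_assoc)
qed

lemma tri_e_closed: "tri_e \<in> triangulations 0"
  unfolding triangulations_0 by simp

lemma tri_oplus_e_left:
  assumes "T \<in> triangulations n"
  shows "tri_oplus tri_e T = T"
proof -
  have "relabel (\<lambda>j. if j = 1 then 1 else 0 + j) T = relabel (\<lambda>j. j) T"
    by (rule relabel_cong) auto
  then show ?thesis
    unfolding tri_oplus_eq[OF tri_e_closed] using triangulation_first_edge[OF assms]
    by (auto simp: relabel_def tri_e_def)
qed

lemma tri_oplus_e_right:
  assumes "T \<in> triangulations n"
  shows "tri_oplus T tri_e = T"
proof -
  have "(\<lambda>j. if j = 1 then 1 else n + j) ` {1, 2} = {1, n + 2}"
    by auto
  then show ?thesis
    unfolding tri_oplus_eq[OF assms] tri_e_def relabel_insert relabel_empty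
    using triangulation_last_edge[OF assms] by (simp only:) blast
qed

lemma tri_carrier_iff: "t \<in> tri.carrier \<longleftrightarrow> (\<exists>n. t \<in> triangulations n)"
  unfolding tri.carrier_def by simp

lemma lam_oplus_neq_e:
  assumes "u \<in> tri.carrier" "v \<in> tri.carrier"
  shows "tri_oplus (tri_lam u) v \<noteq> tri_e"
proof
  assume eq: "tri_oplus (tri_lam u) v = tri_e"
  obtain a b where "u \<in> triangulations a" "v \<in> triangulations b"
    using assms tri_carrier_iff by blast
  then have "tri_e \<in> triangulations (Suc a + b)"
    using tri_oplus_closed tri_lam_closed eq by metis
  then show False
    using tri_size_triangulation tri_e_closed by (metis add_Suc nat.distinct(1))
qed

text \<open>Treats an indecomposable as the case \<open>v = tri_e\<close> of
  \<open>tri_oplus (tri_lam u) v\<close>. Uniqueness of this normal form then yields both the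
  exclusion between the two nonempty forms and the uniqueness within each.\<close>

lemma tri_lam_oplus_e: "s \<in> tri.carrier \<Longrightarrow> tri_oplus (tri_lam s) tri_e = tri_lam s"
  using tri_carrier_iff tri_lam_closed tri_oplus_e_right by blast

lemma tri_e_carrier: "tri_e \<in> tri.carrier"
  using tri_carrier_iff tri_e_closed by blast

lemma tri_carrier_lam_oplus_unique:
  assumes "u \<in> tri.carrier" "v \<in> tri.carrier" "u' \<in> tri.carrier" "v' \<in> tri.carrier"
    "tri_oplus (tri_lam u) v = tri_oplus (tri_lam u') v'"
  shows "u = u' \<and> v = v'"
  using assms lam_oplus_unique unfolding tri_carrier_iff by blast

lemma tri_indecomposableE:
  assumes "tri.indecomposable t"
  obtains s where "s \<in> tri.carrier" "t = tri_lam s"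
  using assms unfolding tri.indecomposable_def by blast

interpretation tri_catalan: catalan_structure triangulations tri_e tri_lam tri_oplus
proof
  show "triangulations m \<inter> triangulations n = {}" if "m \<noteq> n" for m n
    using that tri_size_triangulation by blast
  show "triangulations 0 = {tri_e}"
    by (rule triangulations_0)
  show "tri_lam t \<in> triangulations (Suc n)" if "t \<in> triangulations n" for t n
    using that by (rule tri_lam_closed)
  show "tri_oplus s t \<in> triangulations (m + n)"
    if "s \<in> triangulations m" "t \<in> triangulations n" for s t m n
    using that by (rule tri_oplus_closed)
  show "tri_oplus (tri_oplus r s) t = tri_oplus r (tri_oplus s t)"
    if "r \<in> tri.carrier" "s \<in> tri.carrier" "t \<in> tri.carrier" for r s t
    using that tri_oplus_assoc unfolding tri_carrier_iff by blast
  show "tri_oplus tri_e t = t" if "t \<in> tri.carrier" for t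
    using that tri_oplus_e_left unfolding tri_carrier_iff by blast
  show "tri_oplus t tri_e = t" if "t \<in> tri.carrier" for t
    using that tri_oplus_e_right unfolding tri_carrier_iff by blast
  show "t = tri_e \<or> tri.indecomposable t \<or> tri.decomposable t" if t: "t \<in> tri.carrier" for t
  proof -
    obtain n where n: "t \<in> triangulations n"
      using t tri_carrier_iff by blast
    show ?thesis
    proof (cases "n = 0")
      case True
      then show ?thesis
        using n triangulations_0 by simp
    next
      case False
      then obtain a b u v where uv: "u \<in> triangulations a" "v \<in> triangulations b"
        "t = tri_oplus (tri_lam u) v"
        using triangulation_decompose[OF n] by metis
      then have "u \<in> tri.carrier" "v \<in> tri.carrier"
        using tri_carrier_iff by blast+
      then show ?thesis
        using uv(3) tri_lam_oplus_e
        unfolding tri.decomposable_def tri.indecomposable_def by metis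
    qed
  qed
  show "\<not> tri.indecomposable tri_e"
    using lam_oplus_neq_e tri_e_carrier tri_lam_oplus_e by (metis tri_indecomposableE)
  show "\<not> tri.decomposable tri_e"
    using lam_oplus_neq_e unfolding tri.decomposable_def by (metis tri_indecomposableE)
  show "\<not> tri.decomposable t" if "tri.indecomposable t" for t
    using that tri_carrier_lam_oplus_unique tri_e_carrier tri_lam_oplus_e
    unfolding tri.decomposable_def by (metis tri_indecomposableE)
  show "s = s'" if "s \<in> tri.carrier" "s' \<in> tri.carrier" "tri_lam s = tri_lam s'" for s s'
    using that tri_carrier_lam_oplus_unique[OF _ tri_e_carrier _ tri_e_carrier] by metis
  show "u = u' \<and> v = v'"
    if "tri.indecomposable u" "v \<in> tri.carrier" "v \<noteq> tri_e"
      "tri.indecomposable u'" "v' \<in> tri.carrier" "v' \<noteq> tri_e"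
      "tri_oplus u v = tri_oplus u' v'" for u u' v v'
    using that tri_carrier_lam_oplus_unique by (metis tri_indecomposableE)
qed

section \<open>Gluing at the last boundary edge\<close>

text \<open>The closed form of \<open>ominus\<close>. The \<open>n\<close> inner vertices of
  \<open>V\<close> go between \<open>m + 1\<close> and \<open>m + 2\<close>, so among the labels of
  \<open>S\<close> only \<open>m + 2\<close> moves, to the end.\<close>

definition last_glue :: "nat \<Rightarrow> nat \<Rightarrow> edge_set \<Rightarrow> edge_set \<Rightarrow> edge_set" where
  "last_glue m n S V =
    relabel (\<lambda>i. if i = m + 2 then m + n + 2 else i) S \<union> relabel (\<lambda>j. m + j) V"

lemma last_glue_e:
  assumes "V \<in> triangulations n"
  shows "last_glue 0 n tri_e V = V"
proof -
  have "(\<lambda>i. if i = 0 + 2 then 0 + n + 2 else i) ` {1, 2} = {1, n + 2}"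
    by auto
  moreover have "relabel (\<lambda>j. 0 + j) V = V"
    by (simp add: relabel_def)
  ultimately show ?thesis
    unfolding last_glue_def tri_e_def relabel_insert relabel_empty
    using triangulation_last_edge[OF assms] by (simp only:) blast
qed

text \<open>The shift carries the gluing edge \<open>{a + 1, a + 2}\<close> of \<open>u\<close> to
  \<open>{a + 2, a + 3}\<close>, the gluing edge of \<open>tri_lam u\<close>. The membership
  hypothesis fixes the size that \<open>tri_lam\<close> reads off.\<close>

lemma last_glue_lam:
  assumes "u \<in> triangulations a" "last_glue a n u V \<in> triangulations (a + n)"
  shows "last_glue (a + 1) n (tri_lam u) V = tri_lam (last_glue a n u V)"
proof -
  have 1: "relabel (\<lambda>x. if x + 1 = a + 1 + 2 then a + 1 + n + 2 else x + 1) u =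
      relabel (\<lambda>x. (if x = a + 2 then a + n + 2 else x) + 1) u"
    by (rule relabel_cong) auto
  have 2: "relabel (\<lambda>j. a + 1 + j) V = relabel (\<lambda>x. a + x + 1) V"
    by (rule relabel_cong) auto
  show ?thesis
    unfolding tri_lam_eq[OF assms(1)] tri_lam_eq[OF assms(2)]
    unfolding last_glue_def relabel_Un relabel_relabel relabel_insert relabel_empty 1 2
    by auto
qed

text \<open>For \<open>b \<noteq> 0\<close> the gluing edge of the sum is that of \<open>v\<close>
  moved by \<open>a + 1\<close>, so \<open>tri_lam u\<close> is untouched; for \<open>b = 0\<close>
  it would lie in \<open>tri_lam u\<close>.\<close>

lemma last_glue_lam_oplus:
  assumes "u \<in> triangulations a" "v \<in> triangulations b" "V \<in> triangulations n" "b \<noteq> 0"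
  shows "last_glue (a + b + 1) n (tri_oplus (tri_lam u) v) V =
    tri_oplus (tri_lam u) (last_glue b n v V)"
proof -
  let ?g = "\<lambda>i. if i = a + b + 1 + 2 then a + b + 1 + n + 2 else i"
  have 1: "relabel ?g (tri_lam u) = tri_lam u"
  proof -
    \<comment> \<open>Labels of \<open>tri_lam u\<close> are at most \<open>a + 3\<close>, below the
      only moved label \<open>a + b + 3\<close>.\<close>
    have "relabel ?g (tri_lam u) = relabel (\<lambda>x. x) (tri_lam u)"
      using triangulation_vertex[OF tri_lam_closed[OF assms(1)]] assms(4)
      by (intro relabel_cong) fastforce
    then show ?thesis
      unfolding relabel_def by simp
  qed
  have 2: "relabel (\<lambda>x. ?g (if x = 1 then 1 else Suc a + x)) v =
      relabel (\<lambda>x. if (if x = b + 2 then b + n + 2 else x) = 1 then 1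
        else Suc a + (if x = b + 2 then b + n + 2 else x)) v"
    by (rule relabel_cong) auto
  \<comment> \<open>\<open>b \<noteq> 0\<close> and \<open>1 \<le> x\<close> exclude
    \<open>b + x = 1\<close>, so the special case for label \<open>1\<close> never applies.\<close>
  have 3: "relabel (\<lambda>j. a + b + 1 + j) V = relabel (\<lambda>x. if b + x = 1 then 1 else Suc a + (b + x)) V"
    by (rule relabel_cong) (use triangulation_vertex[OF assms(3)] assms(4) in fastforce)
  show ?thesis
    unfolding tri_oplus_eq[OF tri_lam_closed[OF assms(1)]]
    unfolding last_glue_def relabel_Un relabel_relabel 1 2 3 Un_assoc ..
qed

text \<open>Induction along the decomposition: \<open>b = 0\<close> uses the clause of
  \<open>ominus\<close> for \<open>tri_lam\<close>, \<open>b \<noteq> 0\<close> the clause for sums.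
  Membership is carried along because \<open>tri_lam\<close> depends on the size of the recursive
  result.\<close>

lemma tri_ominus_eq:
  assumes "S \<in> triangulations m" "V \<in> triangulations n"
  shows "tri.ominus S V = last_glue m n S V \<and> tri.ominus S V \<in> triangulations (m + n)"
  using assms(1)
proof (induction m arbitrary: S rule: less_induct)
  case (less m)
  have V: "V \<in> tri.carrier"
    using assms(2) tri_carrier_iff by blast
  show ?case
  proof (cases "m = 0")
    case True
    then have "S = tri_e"
      using less.prems triangulations_0 by simp
    then show ?thesis
      using True tri_catalan.ominus_e[OF V] last_glue_e assms(2) by simp
  next
    case False
    then obtain a b u v where uv: "u \<in> triangulations a" "v \<in> triangulations b" "m = a + b + 1"
      "S = tri_oplus (tri_lam u) v"
      using triangulation_decompose[OF less.prems] by metis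
    have carr: "u \<in> tri.carrier" "v \<in> tri.carrier"
      using uv tri_carrier_iff by blast+
    show ?thesis
    proof (cases "b = 0")
      case True
      then have S: "S = tri_lam u"
        using uv triangulations_0 tri_lam_oplus_e carr by simp
      have IH: "tri.ominus u V = last_glue a n u V" "last_glue a n u V \<in> triangulations (a + n)"
        using less.IH[of a u] uv by auto
      have "tri.ominus S V = tri_lam (last_glue a n u V)"
        unfolding S tri_catalan.ominus_lam[OF carr(1) V] IH(1) ..
      then show ?thesis
        using last_glue_lam[OF uv(1) IH(2)] tri_lam_closed[OF IH(2)] S True uv(3) by simp
    next
      case False
      have ne: "v \<noteq> tri_e" "tri_lam u \<noteq> tri_e"
        using False tri_size_triangulation[OF uv(2)] tri_size_triangulation[OF tri_e_closed]
          tri_catalan.lam_neq_e[OF carr(1)]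
        by auto
      have IH: "tri.ominus v V = last_glue b n v V" "last_glue b n v V \<in> triangulations (b + n)"
        using less.IH[of b v] uv by auto
      have "tri.ominus S V = tri_oplus (tri_lam u) (last_glue b n v V)"
        unfolding uv(4) IH(1)[symmetric]
        by (rule tri_catalan.ominus_oplus[OF tri_catalan.lam_carrier[OF carr(1)]
              ne(2) carr(2) ne(1) V])
      then show ?thesis
        using last_glue_lam_oplus[OF uv(1,2) assms(2) False] uv(3,4)
          tri_oplus_closed[OF tri_lam_closed[OF uv(1)] IH(2)] by (simp add: add.assoc)
    qed
  qed
qed

section \<open>The reflection\<close>

text \<open>\<open>tri_lam tri_e\<close> is the triangle on \<open>1\<close>, \<open>2\<close>,
  \<open>3\<close>, and the sum puts its edge \<open>{1, 2}\<close> on the last edge of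
  \<open>T\<close>.\<close>

lemma tri_gamma_eq:
  assumes "T \<in> triangulations n"
  shows "tri.gamma T = T \<union> {{1, n + 2}, {1, n + 3}, {n + 2, n + 3}}"
    and "tri.gamma T \<in> triangulations (n + 1)"
proof -
  have lam_e: "tri_lam tri_e = {{1, 2}, {1, 3}, {2, 3}}"
    unfolding tri_lam_eq[OF tri_e_closed] by (auto simp: tri_e_def relabel_def numeral_eq_Suc)
  show "tri.gamma T = T \<union> {{1, n + 2}, {1, n + 3}, {n + 2, n + 3}}"
    unfolding tri.gamma_def tri_oplus_eq[OF assms] lam_e
    by (simp add: relabel_insert relabel_empty insert_commute)
  show "tri.gamma T \<in> triangulations (n + 1)"
    using tri_oplus_closed[OF assms tri_lam_closed[OF tri_e_closed]] unfolding tri.gamma_def by simp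
qed

text \<open>The apex \<open>a + 3\<close> reflects to \<open>b + 1\<close>. The triangle on
  \<open>{1, 2}\<close> becomes the one added by \<open>gamma\<close>, moved by \<open>b\<close>;
  the \<open>u\<close> part becomes the reflection of \<open>u\<close> moved by \<open>b\<close>;
  the \<open>v\<close> part becomes the reflection of \<open>v\<close> with its last vertex moved to
  the end.\<close>

lemma reflect_lam_oplus:
  assumes "u \<in> triangulations a" "v \<in> triangulations b"
    and ru: "relabel (\<lambda>i. a + 3 - i) u \<in> triangulations a"
  shows "relabel (\<lambda>i. a + b + 1 + 3 - i) (tri_oplus (tri_lam u) v) =
    last_glue b (a + 1) (relabel (\<lambda>i. b + 3 - i) v) (tri.gamma (relabel (\<lambda>i. a + 3 - i) u))"
proof -
  \<comment> \<open>\<open>x \<le> a + 2\<close> keeps the truncated subtraction exact.\<close>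
  have 1: "relabel (\<lambda>x. a + b + 1 + 3 - (x + 1)) u = relabel (\<lambda>x. b + (a + 3 - x)) u"
    by (rule relabel_cong) (use triangulation_vertex[OF assms(1)] in fastforce)
  \<comment> \<open>Vertex \<open>1\<close> of \<open>v\<close> is vertex \<open>1\<close> of the
    sum and reflects to \<open>a + b + 3\<close>. Reflected within \<open>v\<close> it gets
    \<open>b + 2\<close>, the one label that \<open>last_glue\<close> moves.\<close>
  have 2: "relabel (\<lambda>x. a + b + 1 + 3 - (if x = 1 then 1 else a + 1 + x)) v =
      relabel (\<lambda>x. if b + 3 - x = b + 2 then b + (a + 1) + 2 else b + 3 - x) v"
  proof (rule relabel_cong)
    fix s x assume "s \<in> v" "x \<in> s"
    then have "1 \<le> x" "x \<le> b + 2"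
      using triangulation_vertex[OF assms(2)] by blast+
    then show "a + b + 1 + 3 - (if x = 1 then 1 else a + 1 + x) =
        (if b + 3 - x = b + 2 then b + (a + 1) + 2 else b + 3 - x)"
      by auto
  qed
  \<comment> \<open>The third side of the triangle in \<open>gamma\<close> is not listed by
    \<open>tri_lam\<close>; it is the reflected last edge of \<open>u\<close>.\<close>
  have "(\<lambda>x. b + (a + 3 - x)) ` {1, a + 2} \<in> relabel (\<lambda>x. b + (a + 3 - x)) u"
    using triangulation_last_edge[OF assms(1)] unfolding relabel_def by blast
  then have 3: "{b + 1, b + (a + 2)} \<in> relabel (\<lambda>x. b + (a + 3 - x)) u"
    by (simp add: insert_commute numeral_eq_Suc)
  have 4: "a + b + 1 + 3 - 1 = b + (a + 3)" "a + b + 1 + 3 - 2 = b + (a + 2)"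
    "a + b + 1 + 3 - (a + 3) = b + 1"
    by simp_all
  have 5: "{b + (a + 3), b + (a + 2)} = {b + (a + 2), b + (a + 3)}"
    "{b + (a + 3), b + 1} = {b + 1, b + (a + 3)}"
    by (rule insert_commute)+
  show ?thesis
    unfolding lam_oplus_eq[OF assms(1)] last_glue_def tri_gamma_eq(1)[OF ru]
      relabel_Un relabel_relabel relabel_insert relabel_empty 1 2 image_insert image_empty 4 5
    using 3 by blast
qed

text \<open>Membership is proved in the same induction, through \<open>tri_ominus_eq\<close>: the
  reflection is decreasing, so \<open>polytri_relabel\<close> does not cover it.\<close>

lemma tri_h_eq:
  assumes "T \<in> triangulations n"
  shows "tri.h T = relabel (\<lambda>i. n + 3 - i) T \<and> tri.h T \<in> triangulations n"
  using assms
proof (induction n arbitrary: T rule: less_induct)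
  case (less n)
  show ?case
  proof (cases "n = 0")
    case True
    then have "T = tri_e"
      using less.prems triangulations_0 by simp
    \<comment> \<open>Here \<open>i \<mapsto> 3 - i\<close> swaps \<open>1\<close> and
      \<open>2\<close>, which fixes the unordered edge.\<close>
    then show ?thesis
      using True tri_catalan.h_e tri_e_closed by (auto simp: tri_e_def relabel_def)
  next
    case False
    then obtain a b u v where uv: "u \<in> triangulations a" "v \<in> triangulations b" "n = a + b + 1"
      "T = tri_oplus (tri_lam u) v"
      using triangulation_decompose[OF less.prems] by metis
    have carr: "u \<in> tri.carrier" "v \<in> tri.carrier"
      using uv tri_carrier_iff by blast+
    have IHu: "tri.h u = relabel (\<lambda>i. a + 3 - i) u" "tri.h u \<in> triangulations a"
      using less.IH[of a u] uv by auto
    have IHv: "tri.h v = relabel (\<lambda>i. b + 3 - i) v" "tri.h v \<in> triangulations b"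
      using less.IH[of b v] uv by auto
    have hT: "tri.h T = tri.ominus (tri.h v) (tri.gamma (tri.h u))"
      unfolding uv(4) by (rule tri_catalan.h_lam_oplus[OF carr])
    have om: "tri.ominus (tri.h v) (tri.gamma (tri.h u)) =
        last_glue b (a + 1) (tri.h v) (tri.gamma (tri.h u))"
      "tri.ominus (tri.h v) (tri.gamma (tri.h u)) \<in> triangulations (b + (a + 1))"
      using tri_ominus_eq[OF IHv(2) tri_gamma_eq(2)[OF IHu(2)]] by blast+
    have "relabel (\<lambda>i. a + 3 - i) u \<in> triangulations a"
      using IHu by simp
    then have "tri.h T = relabel (\<lambda>i. n + 3 - i) T"
      unfolding hT om(1) unfolding IHv(1) IHu(1) uv(3,4)
      by (rule reflect_lam_oplus[OF uv(1,2), symmetric])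
    moreover have "tri.h T \<in> triangulations n"
      using om(2) uv(3) unfolding hT by (simp add: ac_simps)
    ultimately show ?thesis
      by blast
  qed
qed

theorem proposition3p1:
  fixes n :: nat and T :: edge_set
  assumes "T \<in> triangulations n"
  shows "tri.h T = relabel (\<lambda>i. n + 3 - i) T \<and>
    tri.h T \<in> triangulations n \<and>
    tri.h T = {{n + 3 - i, n + 3 - j} | i j. {i, j} \<in> T}"
proof -
  \<comment> \<open>Every element of \<open>T\<close> is a pair, so the images of edges are exactly
    the pairs of images.\<close>
  have "relabel (\<lambda>i. n + 3 - i) T = {{n + 3 - i, n + 3 - j} | i j. {i, j} \<in> T}"
  proof (intro equalityI subsetI)
    fix s assume "s \<in> relabel (\<lambda>i. n + 3 - i) T"
    then obtain t where t: "t \<in> T" "s = (\<lambda>i. n + 3 - i) ` t"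
      unfolding relabel_def by blast
    obtain i j where "t = {i, j}"
      using triangulation_edge[OF assms t(1)] by blast
    then show "s \<in> {{n + 3 - i, n + 3 - j} | i j. {i, j} \<in> T}"
      using t by auto
  next
    fix s assume "s \<in> {{n + 3 - i, n + 3 - j} | i j. {i, j} \<in> T}"
    then obtain i j where "{i, j} \<in> T" "s = (\<lambda>i. n + 3 - i) ` {i, j}"
      by auto
    then show "s \<in> relabel (\<lambda>i. n + 3 - i) T"
      unfolding relabel_def by blast
  qed
  then show ?thesis
    using tri_h_eq[OF assms] by metis
qed

end
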